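(* Let $G=*_C G_i$ ($i\in I$) be an amalgamated free product of groups $G_i$ over a common subgroup $C$. For each $i\in I$ let $P_i$ be a normal subsemigroup of $G_i$, and suppose $P_i\cap C=P_j\cap C$ for all $i,j\in I$. Then $G_i\cap\mathrm{NSS}_G\big(\bigcup_{j\in I}P_j\big)=P_i$ for every $i\in I$.
   Context: A normal subsemigroup of a group $H$ is a (possibly empty) subset closed under multiplication and under conjugation by elements of $H$. For $S\subseteq H$, $\mathrm{NSS}_H(S)=\{s_1^{h_1}\cdots s_n^{h_n}: n\ge1,\ s_i\in S,\ h_i\in H\}$, where $x^y=y^{-1}xy$. Each $G_i$ is regarded as a subgroup of $G$ and $C=G_i\cap G_j$ for $i\neq j$. *)

theory Defs
  imports "HOL-Algebra.Algebra"
begin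

definition normal_subsemigroup :: "('a, 'b) monoid_scheme \<Rightarrow> 'a set \<Rightarrow> bool" where
  "normal_subsemigroup H P \<longleftrightarrow>
     P \<subseteq> carrier H \<and>
     (\<forall>x\<in>P. \<forall>y\<in>P. x \<otimes>\<^bsub>H\<^esub> y \<in> P) \<and>
     (\<forall>x\<in>P. \<forall>h\<in>carrier H. inv\<^bsub>H\<^esub> h \<otimes>\<^bsub>H\<^esub> x \<otimes>\<^bsub>H\<^esub> h \<in> P)"

definition NSS :: "('a, 'b) monoid_scheme \<Rightarrow> 'a set \<Rightarrow> 'a set" where
  "NSS H S = {foldr (\<lambda>(s, h) acc. (inv\<^bsub>H\<^esub> h \<otimes>\<^bsub>H\<^esub> s \<otimes>\<^bsub>H\<^esub> h) \<otimes>\<^bsub>H\<^esub> acc) ps \<one>\<^bsub>H\<^esub>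
             | ps. ps \<noteq> [] \<and> (\<forall>p\<in>set ps. fst p \<in> S \<and> snd p \<in> carrier H)}"

(* G is the (internal) amalgamated free product of the subgroups Gi i (i in I)
   over the common subgroup C: C is a subgroup contained in every Gi i,
   Gi i \<inter> Gi j = C for i \<noteq> j, G is generated by the Gi i, and every reduced
   word g_1 ... g_n (n >= 1, g_k in Gi(i_k) - C, consecutive indices distinct)
   is nontrivial (normal form theorem characterisation). *)
definition amalgamated_free_product ::
  "('a, 'b) monoid_scheme \<Rightarrow> 'i set \<Rightarrow> ('i \<Rightarrow> 'a set) \<Rightarrow> 'a set \<Rightarrow> bool" where
  "amalgamated_free_product G I Gi C \<longleftrightarrow>
     group G \<and> subgroup C G \<and>
     (\<forall>i\<in>I. subgroup (Gi i) G \<and> C \<subseteq> Gi i) \<and>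
     (\<forall>i\<in>I. \<forall>j\<in>I. i \<noteq> j \<longrightarrow> Gi i \<inter> Gi j = C) \<and>
     generate G (\<Union>i\<in>I. Gi i) = carrier G \<and>
     (\<forall>ws :: ('i \<times> 'a) list.
        ws \<noteq> [] \<and>
        (\<forall>k < length ws. fst (ws ! k) \<in> I \<and> snd (ws ! k) \<in> Gi (fst (ws ! k)) - C) \<and>
        (\<forall>k. Suc k < length ws \<longrightarrow> fst (ws ! k) \<noteq> fst (ws ! Suc k))
        \<longrightarrow> foldr (\<lambda>w acc. snd w \<otimes>\<^bsub>G\<^esub> acc) ws \<one>\<^bsub>G\<^esub> \<noteq> \<one>\<^bsub>G\<^esub>)"

end

theory Submission
  imports Defs
begin

text \<open>The length of reduced words is a Lyndon length function: it is half the displacement of the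
  base edge in the Bass--Serre tree. Suppose a product of conjugates of elements of the P j lies in
  Gi i. As in Nielsen reduction, adjacent factors a, b are replaced by (a b a^{-1}, a) or
  (b, b^{-1} a b), or merged when they fix the same vertex, as long as this shortens the sequence,
  decreases the total length or moves a shorter factor to the right. In the end the path
  traced by the partial products is locally geodesic after cancellation, so n factors give a product
  of length at least n; as elements of Gi i have length at most 1, only one factor is left.
  A last factor that lies in C lies in every P j and can be split off.\<close>

locale amalgam = group G for G :: "('a, 'b) monoid_scheme" (structure) +
  fixes I :: "'i set" and Gi :: "'i \<Rightarrow> 'a set" and C :: "'a set"
  assumes amal: "amalgamated_free_product G I Gi C"
begin

section \<open>The amalgamated subgroup and the factors\<close>

lemma subgroup_C: "subgroup C G"
  using amal by (simp add: amalgamated_free_product_def)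

lemma subgroup_Gi: "i \<in> I \<Longrightarrow> subgroup (Gi i) G"
  using amal by (simp add: amalgamated_free_product_def)

lemma C_sub_Gi: "i \<in> I \<Longrightarrow> x \<in> C \<Longrightarrow> x \<in> Gi i"
  using amal by (auto simp: amalgamated_free_product_def)

lemma Gi_Int: "i \<in> I \<Longrightarrow> j \<in> I \<Longrightarrow> x \<in> Gi i \<Longrightarrow> x \<in> Gi j \<Longrightarrow> x \<notin> C \<Longrightarrow> i = j"
  using amal unfolding amalgamated_free_product_def by blast

lemma C_carrier [simp]: "x \<in> C \<Longrightarrow> x \<in> carrier G"
  using subgroup.mem_carrier[OF subgroup_C] .

lemma Gi_carrier: "i \<in> I \<Longrightarrow> x \<in> Gi i \<Longrightarrow> x \<in> carrier G"
  using subgroup.mem_carrier[OF subgroup_Gi] .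

lemma C_closed [simp]: "\<one> \<in> C" "x \<in> C \<Longrightarrow> inv x \<in> C" "x \<in> C \<Longrightarrow> y \<in> C \<Longrightarrow> x \<otimes> y \<in> C"
  using subgroup_C by (auto simp: subgroup.one_closed subgroup.m_inv_closed subgroup.m_closed)

lemma Gi_closed:
  assumes "i \<in> I"
  shows "x \<in> Gi i \<Longrightarrow> inv x \<in> Gi i" "x \<in> Gi i \<Longrightarrow> y \<in> Gi i \<Longrightarrow> x \<otimes> y \<in> Gi i"
  using subgroup_Gi[OF assms] by (auto simp: subgroup.m_inv_closed subgroup.m_closed)

lemma mult_inv_cancel [simp]:
  assumes "x \<in> carrier G" "y \<in> carrier G"
  shows "x \<otimes> (inv x \<otimes> y) = y" "inv x \<otimes> (x \<otimes> y) = y"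
  using assms by (simp_all add: m_assoc[symmetric])

lemma mult_notin_C:
  assumes "x \<in> carrier G" "x \<notin> C" "c \<in> C"
  shows "c \<otimes> x \<notin> C" "x \<otimes> c \<notin> C" "inv x \<notin> C"
proof -
  show "c \<otimes> x \<notin> C"
  proof
    assume "c \<otimes> x \<in> C"
    then have "inv c \<otimes> (c \<otimes> x) \<in> C"
      using assms by (intro C_closed(3)[OF C_closed(2)])
    then show False using assms by (simp add: m_assoc[symmetric])
  qed
  show "x \<otimes> c \<notin> C"
  proof
    assume "x \<otimes> c \<in> C"
    then have "(x \<otimes> c) \<otimes> inv c \<in> C"
      using assms by (intro C_closed(3)[OF _ C_closed(2)])
    then show False using assms by (simp add: m_assoc)
  qed
  show "inv x \<notin> C"
    using assms(1,2) C_closed(2)[of "inv x"] by auto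
qed

section \<open>Reduced words\<close>

primrec red :: "('i \<times> 'a) list \<Rightarrow> bool" where
  "red [] \<longleftrightarrow> True"
| "red (p # w) \<longleftrightarrow> fst p \<in> I \<and> snd p \<in> Gi (fst p) \<and> snd p \<notin> C \<and>
     (w = [] \<or> fst p \<noteq> fst (hd w)) \<and> red w"

primrec wprod :: "('i \<times> 'a) list \<Rightarrow> 'a" where
  "wprod [] = \<one>"
| "wprod (p # w) = snd p \<otimes> wprod w"

lemma wprod_closed [simp]: "red w \<Longrightarrow> wprod w \<in> carrier G"
  by (induction w) (auto simp: Gi_carrier)

lemma red_nth:
  assumes "red w"
  shows "k < length w \<Longrightarrow> fst (w ! k) \<in> I \<and> snd (w ! k) \<in> Gi (fst (w ! k)) - C"
    and "Suc k < length w \<Longrightarrow> fst (w ! k) \<noteq> fst (w ! Suc k)"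
proof -
  show "k < length w \<Longrightarrow> fst (w ! k) \<in> I \<and> snd (w ! k) \<in> Gi (fst (w ! k)) - C"
    using assms by (induction w arbitrary: k) (auto simp: nth_Cons split: nat.splits)
  show "Suc k < length w \<Longrightarrow> fst (w ! k) \<noteq> fst (w ! Suc k)"
    using assms by (induction w arbitrary: k) (auto simp: nth_Cons hd_conv_nth split: nat.splits)
qed

lemma wprod_red_neq_one:
  assumes "red w" "w \<noteq> []"
  shows "wprod w \<noteq> \<one>"
proof -
  have "foldr (\<lambda>p acc. snd p \<otimes> acc) w \<one> \<noteq> \<one>"
    using amal assms red_nth[OF assms(1)] unfolding amalgamated_free_product_def by blast
  moreover have "foldr (\<lambda>p acc. snd p \<otimes> acc) w \<one> = wprod w"
    by (induction w) auto
  ultimately show ?thesis by simp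
qed

text \<open>Otherwise \<open>e\<close> lies in \<open>C\<close> and can be absorbed into the first
  syllable of \<open>w\<close>, giving a nonempty reduced word with product
  \<open>\<one>\<close>.\<close>

lemma wprod_red_notin_C:
  assumes "red w" "w \<noteq> []" "c \<in> C"
  shows "c \<otimes> wprod w \<notin> C"
proof
  assume d: "c \<otimes> wprod w \<in> C"
  obtain i x u where w: "w = (i, x) # u" using assms(2) by (metis list.exhaust surj_pair)
  define e where "e = inv (c \<otimes> wprod w) \<otimes> c"
  have i: "i \<in> I" "x \<in> Gi i" "x \<notin> C" and xc: "x \<in> carrier G"
    using assms(1) w by (auto intro: Gi_carrier)
  have e: "e \<in> C" using d assms(3) by (simp add: e_def)
  have "red ((i, e \<otimes> x) # u)"
    using assms(1) w e i xc mult_notin_C[of x e] by (auto intro: Gi_closed C_sub_Gi)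
  then have "wprod ((i, e \<otimes> x) # u) \<noteq> \<one>" by (intro wprod_red_neq_one) auto
  moreover have "wprod ((i, e \<otimes> x) # u) = e \<otimes> wprod w"
    using w e xc assms(1) by (simp add: m_assoc)
  moreover have "e \<otimes> wprod w = \<one>"
    using assms by (simp add: e_def m_assoc)
  ultimately show False by simp
qed

section \<open>Normal forms and the length function\<close>

text \<open>A relation at first: uniqueness and existence of the length are proved below, and only
  then does \<open>len\<close> select it.\<close>

definition has_len :: "'a \<Rightarrow> nat \<Rightarrow> bool" where
  "has_len g n \<longleftrightarrow> (\<exists>c w. c \<in> C \<and> red w \<and> g = c \<otimes> wprod w \<and> length w = n)"

lemma has_lenI: "c \<in> C \<Longrightarrow> red w \<Longrightarrow> has_len (c \<otimes> wprod w) (length w)"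
  unfolding has_len_def by blast

lemma inv_mult_wprod_Cons:
  assumes "red (p # w)" "y \<in> carrier G"
  shows "inv (wprod (p # w)) \<otimes> y = inv (wprod w) \<otimes> (inv (snd p) \<otimes> y)"
  using assms Gi_carrier[of "fst p" "snd p"] by (simp add: inv_mult_group m_assoc)

text \<open>Syllables of \<open>w\<close> move across one at a time: the inverse of the first
  absorbs \<open>c\<close> and becomes the new head of the other word, and reducedness of
  \<open>w\<close> makes the heads differ again.\<close>

lemma has_len_no_cancel:
  assumes "red w" "red u" "w = [] \<or> u = [] \<or> fst (hd w) \<noteq> fst (hd u)" "c \<in> C"
  shows "has_len (inv (wprod w) \<otimes> (c \<otimes> wprod u)) (length w + length u)"
  using assms
proof (induction w arbitrary: c u)
  case Nil
  then show ?case using has_lenI[of c u] by simp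
next
  case (Cons p w)
  obtain i x where p: "p = (i, x)" by fastforce
  have i: "i \<in> I" "x \<in> Gi i" "x \<notin> C" and xc: "x \<in> carrier G"
    using Cons.prems(1) p by (auto intro: Gi_carrier)
  let ?u = "(i, inv x \<otimes> c) # u"
  have "inv x \<otimes> c \<notin> C" using mult_notin_C i xc Cons.prems(4) by simp
  then have r: "red ?u"
    using Cons.prems p i by (auto intro: Gi_closed C_sub_Gi)
  have "has_len (inv (wprod w) \<otimes> (\<one> \<otimes> wprod ?u)) (length w + length ?u)"
    using Cons.prems p r by (intro Cons.IH) auto
  moreover have "inv (wprod (p # w)) \<otimes> (c \<otimes> wprod u) = inv (wprod w) \<otimes> (\<one> \<otimes> wprod ?u)"
    using Cons.prems p xc by (subst inv_mult_wprod_Cons) (auto simp: m_assoc)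
  ultimately show ?case by simp
qed

text \<open>The number of edges shared by the tree paths of the words w and c u, where each syllable
  contributes two edges.\<close>

fun ov :: "'a \<Rightarrow> ('i \<times> 'a) list \<Rightarrow> ('i \<times> 'a) list \<Rightarrow> nat" where
  "ov c (p # w) (q # u) = (if fst p \<noteq> fst q then 0
     else if inv (snd p) \<otimes> c \<otimes> snd q \<in> C then 2 + ov (inv (snd p) \<otimes> c \<otimes> snd q) w u else 1)"
| "ov c [] u = 0"
| "ov c w [] = 0"

lemma ov_Nil2 [simp]: "ov c w [] = 0"
  by (cases w) auto

lemma ov_le: "ov c w u \<le> 2 * length w" "ov c w u \<le> 2 * length u"
  by (induction c w u rule: ov.induct) auto

text \<open>First syllables with quotient in \<open>C\<close> cancel and lose 2; those from the same
  factor with quotient outside \<open>C\<close> merge and lose 1; those from different factors lose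
  nothing.\<close>

lemma has_len_ov:
  assumes "red w" "red u" "c \<in> C"
  shows "\<exists>n. has_len (inv (wprod w) \<otimes> (c \<otimes> wprod u)) n \<and> n + ov c w u = length w + length u"
  using assms
proof (induction c w u rule: ov.induct)
  case (1 c p w q u)
  show ?case
  proof (cases "fst p = fst q")
    case False
    then show ?thesis
      using has_len_no_cancel[of "p # w" "q # u" c] 1(2-4) by fastforce
  next
    case True
    define z where "z = inv (snd p) \<otimes> c \<otimes> snd q"
    have p: "fst p \<in> I" "snd p \<in> Gi (fst p)" "snd q \<in> Gi (fst p)"
      and pq: "snd p \<in> carrier G" "snd q \<in> carrier G"
      using 1(2,3) True Gi_carrier by auto
    have eq: "inv (wprod (p # w)) \<otimes> (c \<otimes> wprod (q # u)) = inv (wprod w) \<otimes> (z \<otimes> wprod u)"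
      using 1(2-4) pq by (subst inv_mult_wprod_Cons) (auto simp: m_assoc z_def)
    show ?thesis
    proof (cases "z \<in> C")
      case True2: True
      then have "\<exists>n. has_len (inv (wprod w) \<otimes> (z \<otimes> wprod u)) n \<and> n + ov z w u = length w + length u"
        using 1 True unfolding z_def by auto
      then show ?thesis unfolding eq using True True2 by (auto simp: z_def[symmetric])
    next
      case False
      have "z \<in> Gi (fst p)"
        unfolding z_def using p 1(4) Gi_closed[OF p(1)] C_sub_Gi[OF p(1)] by metis
      then have "red ((fst p, z) # u)" using 1(3) True False by auto
      then have "has_len (inv (wprod w) \<otimes> (\<one> \<otimes> wprod ((fst p, z) # u))) (length w + length ((fst p, z) # u))"
        using 1(2) by (intro has_len_no_cancel) auto
      moreover have "\<one> \<otimes> wprod ((fst p, z) # u) = z \<otimes> wprod u"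
        using 1(3,4) pq by (simp add: z_def)
      ultimately show ?thesis unfolding eq using True False by (auto simp: z_def[symmetric])
    qed
  qed
next
  case (2 c u)
  then show ?case using has_len_no_cancel[of "[]" u c] by auto
next
  case (3 c p w)
  then show ?case using has_len_no_cancel[of "p # w" "[]" c] by auto
qed

lemma has_len_C: "has_len c n \<Longrightarrow> c \<in> C \<Longrightarrow> n = 0"
  unfolding has_len_def using wprod_red_notin_C by fastforce

text \<open>Dividing one form by the other gives \<open>\<one>\<close>, of length 0, so the overlap
  is \<open>m + n\<close>. It is also at most \<open>2 * m\<close> and at most
  \<open>2 * n\<close>.\<close>

lemma has_len_unique:
  assumes "has_len g m" "has_len g n"
  shows "m = n"
proof -
  obtain c w where w: "c \<in> C" "red w" "g = c \<otimes> wprod w" "length w = m"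
    using assms(1) unfolding has_len_def by auto
  obtain d u where u: "d \<in> C" "red u" "g = d \<otimes> wprod u" "length u = n"
    using assms(2) unfolding has_len_def by auto
  have "inv (wprod w) \<otimes> ((inv c \<otimes> d) \<otimes> wprod u) = inv (wprod w) \<otimes> (inv c \<otimes> (c \<otimes> wprod w))"
    using w u by (metis C_carrier m_assoc inv_closed wprod_closed)
  also have "\<dots> = \<one>" using w by (simp add: m_assoc[symmetric])
  finally obtain k where "has_len \<one> k" "k + ov (inv c \<otimes> d) w u = m + n"
    using has_len_ov[of w u "inv c \<otimes> d"] w u by auto
  moreover from this have "k = 0" using has_len_C by simp
  ultimately show ?thesis using ov_le[of "inv c \<otimes> d" w u] w u by simp
qed

lemma has_len_mult_left:
  assumes "i \<in> I" "x \<in> Gi i" "\<exists>n. has_len g n"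
  shows "\<exists>n. has_len (x \<otimes> g) n"
proof -
  obtain c w where w: "c \<in> C" "red w" "g = c \<otimes> wprod w"
    using assms(3) unfolding has_len_def by auto
  have xc: "x \<otimes> c \<in> Gi i" "x \<otimes> c \<in> carrier G" and x: "x \<in> carrier G"
    using assms w Gi_closed(2)[OF assms(1,2) C_sub_Gi] Gi_carrier by auto
  \<comment> \<open>After absorbing \<open>c\<close>, the new element falls into \<open>C\<close>,
    becomes a new first syllable, or merges with a first syllable from the same factor.\<close>
  consider "x \<otimes> c \<in> C" | "x \<otimes> c \<notin> C" "w = [] \<or> i \<noteq> fst (hd w)"
    | y u where "w = (i, y) # u" by (cases w) (auto, metis)
  then show ?thesis
  proof cases
    case 1
    then show ?thesis using has_lenI[OF 1 w(2)] w x by (auto simp: m_assoc)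
  next
    case 2
    then show ?thesis using has_lenI[of \<one> "(i, x \<otimes> c) # w"] w x xc assms by (auto simp: m_assoc)
  next
    case 3
    have y: "y \<in> Gi i" "y \<in> carrier G" using w(2) 3 Gi_carrier by auto
    have z: "x \<otimes> c \<otimes> y \<in> Gi i" using xc y assms by (auto intro: Gi_closed)
    have eq: "x \<otimes> g = (x \<otimes> c \<otimes> y) \<otimes> wprod u" using w 3 x y by (simp add: m_assoc)
    show ?thesis
    proof (cases "x \<otimes> c \<otimes> y \<in> C")
      case True
      then show ?thesis unfolding eq using has_lenI[OF True, of u] w 3 by auto
    next
      case False
      then show ?thesis unfolding eq
        using has_lenI[of \<one> "(i, x \<otimes> c \<otimes> y) # u"] z w 3 x y assms(1) by auto
    qed
  qed
qed

lemma has_len_exists: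
  assumes "g \<in> carrier G"
  shows "\<exists>n. has_len g n"
proof -
  have "g \<in> generate G (\<Union>i\<in>I. Gi i)"
    using amal assms by (simp add: amalgamated_free_product_def)
  \<comment> \<open>Multiplying an arbitrary \<open>h\<close> instead of \<open>\<one>\<close> lets
    the product case apply both induction hypotheses in turn.\<close>
  then have "\<exists>n. has_len (g \<otimes> h) n" if "\<exists>n. has_len h n" "h \<in> carrier G" for h
    using that
  proof (induction arbitrary: h rule: generate.induct)
    case (eng g1 g2)
    have c: "(\<Union>i\<in>I. Gi i) \<subseteq> carrier G" using Gi_carrier by auto
    have "g1 \<in> carrier G" "g2 \<in> carrier G"
      using eng generate_in_carrier[OF c] by auto
    then show ?case using eng by (simp add: m_assoc)
  qed (auto intro: has_len_mult_left Gi_closed)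
  from this[of \<one>] show ?thesis using has_lenI[of \<one> "[]"] assms by auto
qed

definition len :: "'a \<Rightarrow> nat" where
  "len g = (THE n. has_len g n)"

lemma len_eqI: "has_len g n \<Longrightarrow> len g = n"
  unfolding len_def using has_len_unique by blast

lemma len_wprod:
  assumes "c \<in> C" "red w"
  shows "len (c \<otimes> wprod w) = length w"
  using has_lenI[OF assms] len_eqI by blast

lemma normal_form:
  assumes "g \<in> carrier G"
  obtains c w where "c \<in> C" "red w" "g = c \<otimes> wprod w" "len g = length w"
  using has_len_exists[OF assms] len_wprod unfolding has_len_def by blast

lemma len_eq_0_iff:
  assumes "g \<in> carrier G"
  shows "len g = 0 \<longleftrightarrow> g \<in> C"
proof
  obtain c w where "c \<in> C" "red w" "g = c \<otimes> wprod w" "len g = length w"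
    using normal_form[OF assms] .
  then show "g \<in> C" if "len g = 0" using that by simp
  show "len g = 0" if "g \<in> C"
    using len_wprod[OF that, of "[]"] that by simp
qed

section \<open>Gromov products and hyperbolicity\<close>

text \<open>Twice the Gromov product at the identity for the distance
  \<open>len (inv x \<otimes> y)\<close>; \<open>int\<close> avoids truncated subtraction.\<close>

definition gp :: "'a \<Rightarrow> 'a \<Rightarrow> int" where
  "gp x y = int (len x) + int (len y) - int (len (inv x \<otimes> y))"

lemma gp_eq_ov:
  assumes "c \<in> C" "red w" "d \<in> C" "red u"
  shows "gp (c \<otimes> wprod w) (d \<otimes> wprod u) = int (ov (inv c \<otimes> d) w u)"
proof -
  have "inv (c \<otimes> wprod w) \<otimes> (d \<otimes> wprod u) = inv (wprod w) \<otimes> ((inv c \<otimes> d) \<otimes> wprod u)"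
    using assms by (simp add: inv_mult_group m_assoc)
  moreover obtain n where "has_len (inv (wprod w) \<otimes> ((inv c \<otimes> d) \<otimes> wprod u)) n"
    "n + ov (inv c \<otimes> d) w u = length w + length u"
    using has_len_ov[of w u "inv c \<otimes> d"] assms by auto
  ultimately show ?thesis using len_wprod assms len_eqI by (simp add: gp_def)
qed

lemma gp_nonneg:
  assumes "x \<in> carrier G" "y \<in> carrier G"
  shows "0 \<le> gp x y"
proof -
  obtain c w where w: "c \<in> C" "red w" "x = c \<otimes> wprod w" using normal_form[OF assms(1)] .
  obtain d u where u: "d \<in> C" "red u" "y = d \<otimes> wprod u" using normal_form[OF assms(2)] .
  show ?thesis using gp_eq_ov[OF w(1,2) u(1,2)] w u by simp
qed

lemma len_inv:
  assumes "x \<in> carrier G"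
  shows "len (inv x) = len x"
proof -
  obtain c w where w: "c \<in> C" "red w" "x = c \<otimes> wprod w" "len x = length w"
    using normal_form[OF assms] .
  \<comment> \<open>Nothing cancels against the empty word, and \<open>gp x \<one>\<close> is the
    difference of the two lengths.\<close>
  have "gp x \<one> = 0" using gp_eq_ov[of c w \<one> "[]"] w by simp
  moreover have "len \<one> = 0" by (simp add: len_eq_0_iff)
  ultimately show ?thesis using assms by (simp add: gp_def)
qed

lemma gp_commute:
  assumes "x \<in> carrier G" "y \<in> carrier G"
  shows "gp x y = gp y x"
  using len_inv[of "inv x \<otimes> y"] assms by (simp add: gp_def inv_mult_group)

lemma len_mult_le: "x \<in> carrier G \<Longrightarrow> y \<in> carrier G \<Longrightarrow> len (x \<otimes> y) \<le> len x + len y"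
  using gp_nonneg[of "inv x" y] by (simp add: gp_def len_inv)

text \<open>Quotients of syllables compose, \<open>?a \<otimes> ?b = ?e\<close>. If both lie in
  \<open>C\<close>, so does \<open>?e\<close> and the induction continues; if one does not, the
  minimum is 1, which equal factors already guarantee. If the factors are not all equal, the minimum
  is 0.\<close>

lemma ov_trans:
  assumes "red w" "red u" "red z" "c \<in> C" "d \<in> C"
  shows "min (ov c w u) (ov d u z) \<le> ov (c \<otimes> d) w z"
  using assms
proof (induction c w u arbitrary: d z rule: ov.induct)
  case (1 c p w q u)
  show ?case
  proof (cases z)
    case (Cons r z')
    show ?thesis
    proof (cases "fst p = fst q \<and> fst q = fst r")
      case True
      let ?a = "inv (snd p) \<otimes> c \<otimes> snd q" and ?b = "inv (snd q) \<otimes> d \<otimes> snd r"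
      let ?e = "inv (snd p) \<otimes> (c \<otimes> d) \<otimes> snd r"
      have "snd p \<in> carrier G" "snd q \<in> carrier G" "snd r \<in> carrier G"
        using 1(2-4) Cons Gi_carrier by auto
      then have ab: "?a \<otimes> ?b = ?e"
        using 1(5,6) by (simp add: m_assoc)
      show ?thesis
      proof (cases "?a \<in> C \<and> ?b \<in> C")
        case T2: True
        then have "?e \<in> C" using ab C_closed(3) by metis
        moreover have "min (ov ?a w u) (ov ?b u z') \<le> ov (?a \<otimes> ?b) w z'"
          using 1 T2 True Cons by auto
        ultimately show ?thesis using True T2 Cons ab by simp
      qed (use True Cons in auto)
    qed (use Cons in auto)
  qed simp
qed auto

text \<open>Lyndon's axiom: the Bass--Serre tree is 0-hyperbolic.\<close>

lemma gp_hyperbolic: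
  assumes "x \<in> carrier G" "y \<in> carrier G" "z \<in> carrier G"
  shows "min (gp x y) (gp y z) \<le> gp x z"
proof -
  obtain c w where w: "c \<in> C" "red w" "x = c \<otimes> wprod w" using normal_form[OF assms(1)] .
  obtain d u where u: "d \<in> C" "red u" "y = d \<otimes> wprod u" using normal_form[OF assms(2)] .
  obtain e v where v: "e \<in> C" "red v" "z = e \<otimes> wprod v" using normal_form[OF assms(3)] .
  have "(inv c \<otimes> d) \<otimes> (inv d \<otimes> e) = inv c \<otimes> e"
    using w u v by (simp add: m_assoc)
  then show ?thesis
    using ov_trans[of w u v "inv c \<otimes> d" "inv d \<otimes> e"] w u v by (auto simp: gp_eq_ov min_le_iff_disj)
qed

lemma len_C_mult:
  assumes "c \<in> C" "g \<in> carrier G"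
  shows "len (c \<otimes> g) = len g"
proof -
  obtain d w where w: "d \<in> C" "red w" "g = d \<otimes> wprod w" using normal_form[OF assms(2)] .
  then have "c \<otimes> g = (c \<otimes> d) \<otimes> wprod w" using assms by (simp add: m_assoc)
  then show ?thesis using len_wprod[of "c \<otimes> d" w] len_wprod[of d w] w assms by simp
qed

lemma len_Gi_le_1:
  assumes "i \<in> I" "g \<in> Gi i"
  shows "len g \<le> 1"
proof (cases "g \<in> C")
  case True
  then have "len g = 0" by (simp add: len_eq_0_iff)
  then show ?thesis by simp
next
  case False
  then show ?thesis using len_wprod[of \<one> "[(i, g)]"] assms Gi_carrier[OF assms] by simp
qed

lemma len_Gi_mult_2:
  assumes "i \<in> I" "j \<in> I" "i \<noteq> j" "g \<in> Gi i" "g \<notin> C" "h \<in> Gi j" "h \<notin> C"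
  shows "len (g \<otimes> h) = 2"
  using len_wprod[of \<one> "[(i, g), (j, h)]"] assms Gi_carrier[OF assms(1,4)] Gi_carrier[OF assms(2,6)]
  by simp

section \<open>Conjugates of elements of length one\<close>

text \<open>The length equations say that nothing cancels or merges in the products concerned; the
  one for \<open>inv s\<close> makes the notion stable under inverting \<open>t\<close>.\<close>

definition cyclic_form :: "'a \<Rightarrow> 'a \<Rightarrow> 'a \<Rightarrow> bool" where
  "cyclic_form t x s \<longleftrightarrow> x \<in> carrier G \<and> s \<in> carrier G \<and> len s = 1 \<and> t = inv x \<otimes> s \<otimes> x \<and>
     len t = 2 * len x + 1 \<and> len (s \<otimes> x) = len x + 1 \<and> len (inv s \<otimes> x) = len x + 1"

lemma cyclic_formD:
  assumes "cyclic_form t x s"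
  shows "x \<in> carrier G" "s \<in> carrier G" "len s = 1" "t = inv x \<otimes> s \<otimes> x"
    "len t = 2 * len x + 1" "len (s \<otimes> x) = len x + 1" "len (inv s \<otimes> x) = len x + 1"
  using assms unfolding cyclic_form_def by blast+

lemma cyclic_form_inv:
  assumes "cyclic_form t x s"
  shows "cyclic_form (inv t) x (inv s)"
proof -
  have "inv t = inv x \<otimes> inv s \<otimes> x" "t \<in> carrier G"
    using assms unfolding cyclic_form_def by (auto simp: inv_mult_group m_assoc)
  then show ?thesis using assms len_inv[of t] len_inv[of s] unfolding cyclic_form_def
    by (metis inv_inv inv_closed)
qed

text \<open>Since \<open>x \<otimes> t = s \<otimes> x\<close> has length \<open>len x + 1\<close>,
  the value is the largest possible: the path to \<open>inv x\<close> is an initial segment of the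
  path to \<open>t\<close>.\<close>

lemma gp_cyclic_form:
  assumes "cyclic_form t x s"
  shows "gp t (inv x) = 2 * int (len x)"
proof -
  have c: "x \<in> carrier G" "s \<in> carrier G" "t = inv x \<otimes> s \<otimes> x" "t \<in> carrier G"
    using assms unfolding cyclic_form_def by auto
  have "x \<otimes> t = s \<otimes> x" using c by (simp add: m_assoc)
  then have "gp (inv x) t = 2 * int (len x)"
    using assms c by (simp add: gp_def cyclic_form_def len_inv)
  then show ?thesis using gp_commute c by simp
qed

text \<open>An element t in cyclic form fixes the midpoint of the tree path from the base point to
  its image under t. If a shorter element a cancels at least half of itself against b, then
  the fixed point of b lies behind the midpoint for a, and a cannot move it further away.\<close>

lemma len_conj_le:
  assumes b: "cyclic_form b x s" and a: "a \<in> carrier G" "len a < len b"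
  shows "len (a \<otimes> b) \<le> len b \<Longrightarrow> len (a \<otimes> b \<otimes> inv a) \<le> len b"
    and "len (a \<otimes> b) < len b \<Longrightarrow> odd (len a) \<Longrightarrow> len (a \<otimes> b \<otimes> inv a) < len b"
proof -
  have c: "x \<in> carrier G" "s \<in> carrier G" "b = inv x \<otimes> s \<otimes> x" "b \<in> carrier G"
    and l: "len b = 2 * len x + 1" and s: "len s \<le> 1"
    using b unfolding cyclic_form_def by auto
  \<comment> \<open>The conjugate is \<open>?y \<otimes> s \<otimes> inv ?y\<close>, so it suffices
    to bound \<open>len ?y\<close>, by comparing \<open>inv a\<close> with \<open>inv x\<close>
    through \<open>b\<close>.\<close>
  let ?y = "a \<otimes> inv x"
  have y: "?y \<in> carrier G" using a c by simp
  have "a \<otimes> b \<otimes> inv a = ?y \<otimes> (s \<otimes> inv ?y)"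
    using a c by (simp add: m_assoc inv_mult_group)
  then have le: "len (a \<otimes> b \<otimes> inv a) \<le> 2 * len ?y + 1"
    using len_mult_le[of ?y "s \<otimes> inv ?y"] len_mult_le[of s "inv ?y"] len_inv[OF y] s y c by simp
  have "min (gp (inv a) b) (gp b (inv x)) \<le> gp (inv a) (inv x)"
    using a c by (intro gp_hyperbolic) auto
  then have *: "min (int (len a) + int (len b) - int (len (a \<otimes> b))) (2 * int (len x))
      \<le> int (len a) + int (len x) - int (len ?y)"
    using gp_cyclic_form[OF b] a c by (simp add: gp_def len_inv)
  show "len (a \<otimes> b \<otimes> inv a) \<le> len b" if "len (a \<otimes> b) \<le> len b"
    using that * a(2) l le by linarith
  show "len (a \<otimes> b \<otimes> inv a) < len b" if "len (a \<otimes> b) < len b" "odd (len a)"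
  proof -
    \<comment> \<open>\<open>len a < len b\<close> gives only \<open>len a \<le> 2 * len x\<close>.
      Parity excludes equality, and then the minimum in \<open>*\<close> exceeds
      \<open>len a\<close>.\<close>
    have "len a < 2 * len x" using that(2) a(2) l by (cases "len a = 2 * len x") auto
    then show ?thesis using that(1) * l le by linarith
  qed
qed

section \<open>Products of lists as paths\<close>

primrec lprod :: "'a list \<Rightarrow> 'a" where
  "lprod [] = \<one>"
| "lprod (t # ts) = t \<otimes> lprod ts"

lemma lprod_closed [simp]: "set ts \<subseteq> carrier G \<Longrightarrow> lprod ts \<in> carrier G"
  by (induction ts) auto

lemma lprod_append:
  "set ts \<subseteq> carrier G \<Longrightarrow> set us \<subseteq> carrier G \<Longrightarrow> lprod (ts @ us) = lprod ts \<otimes> lprod us"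
  by (induction ts) (auto simp: m_assoc)

text \<open>Local geodesics in a tree are geodesics: each factor loses at most half of its length on its
  left side and less than half on its right side.\<close>

lemma length_le_len_lprod:
  assumes "ts \<noteq> []" "set ts \<subseteq> carrier G" "last ts \<notin> C"
    and "successively (\<lambda>a b. len b < len (a \<otimes> b) \<and> len a \<le> len (a \<otimes> b)) ts"
  shows "length ts \<le> len (lprod ts) \<and> len (lprod (tl ts)) < len (lprod ts)"
  using assms
proof (induction ts rule: induct_list012)
  case (2 t)
  moreover have "len \<one> = 0" by (simp add: len_eq_0_iff)
  ultimately show ?case using len_eq_0_iff[of t] by simp
next
  case (3 t b us)
  let ?y = "lprod (b # us)"
  have c: "t \<in> carrier G" "b \<in> carrier G" "lprod us \<in> carrier G" "?y \<in> carrier G"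
    using 3(4) by auto
  have IH: "length (b # us) \<le> len ?y" "len (lprod us) < len ?y"
    using 3 by auto
  have tb: "len b < len (t \<otimes> b)" "len t \<le> len (t \<otimes> b)" using 3(6) by auto
  have "gp ?y b = int (len b) + int (len ?y) - int (len (lprod us))"
    using c by (subst gp_commute) (auto simp: gp_def)
  moreover have "gp (inv t) b = int (len t) + int (len b) - int (len (t \<otimes> b))"
    and "gp (inv t) ?y = int (len t) + int (len ?y) - int (len (t \<otimes> ?y))"
    using c by (simp_all add: gp_def len_inv)
  moreover have "min (gp (inv t) ?y) (gp ?y b) \<le> gp (inv t) b"
    using c by (intro gp_hyperbolic) auto
  \<comment> \<open>Here \<open>gp (inv t) b \<le> len b < gp ?y b\<close>, the second inequality by
    the second half of \<open>IH\<close>. So the minimum is \<open>gp (inv t) ?y\<close>, at most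
    \<open>gp (inv t) b < len t\<close>.\<close>
  ultimately have "len ?y < len (t \<otimes> ?y)" using IH tb by linarith
  then show ?case using IH by simp
qed simp

end

section \<open>Conjugates of the given subsemigroups\<close>

locale amalgam_nss = amalgam G I Gi C
  for G :: "('a, 'b) monoid_scheme" (structure) and I :: "'i set" and Gi C +
  fixes P :: "'i \<Rightarrow> 'a set"
  assumes nss: "\<forall>j\<in>I. normal_subsemigroup (G\<lparr>carrier := Gi j\<rparr>) (P j)"
    and P_Int_C: "\<forall>j\<in>I. \<forall>k\<in>I. P j \<inter> C = P k \<inter> C"
begin

lemma P_sub: "j \<in> I \<Longrightarrow> s \<in> P j \<Longrightarrow> s \<in> Gi j"
  using nss by (auto simp: normal_subsemigroup_def)

lemma P_carrier: "j \<in> I \<Longrightarrow> s \<in> P j \<Longrightarrow> s \<in> carrier G"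
  using P_sub Gi_carrier by blast

lemma P_mult: "j \<in> I \<Longrightarrow> s \<in> P j \<Longrightarrow> r \<in> P j \<Longrightarrow> s \<otimes> r \<in> P j"
  using nss by (auto simp: normal_subsemigroup_def)

lemma P_conj: "j \<in> I \<Longrightarrow> s \<in> P j \<Longrightarrow> x \<in> Gi j \<Longrightarrow> inv x \<otimes> s \<otimes> x \<in> P j"
  using nss m_inv_consistent[OF subgroup_Gi] by (auto simp: normal_subsemigroup_def)

lemma P_C: "j \<in> I \<Longrightarrow> k \<in> I \<Longrightarrow> s \<in> P j \<Longrightarrow> s \<in> C \<Longrightarrow> s \<in> P k"
  using P_Int_C by blast

definition conjs :: "'a set" where
  "conjs = {inv x \<otimes> s \<otimes> x | x s j. x \<in> carrier G \<and> j \<in> I \<and> s \<in> P j}"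

lemma conjsI: "x \<in> carrier G \<Longrightarrow> j \<in> I \<Longrightarrow> s \<in> P j \<Longrightarrow> inv x \<otimes> s \<otimes> x \<in> conjs"
  unfolding conjs_def by blast

lemma P_conjs: "j \<in> I \<Longrightarrow> s \<in> P j \<Longrightarrow> s \<in> conjs"
  using conjsI[of \<one> j s] P_carrier by simp

lemma conjs_carrier: "t \<in> conjs \<Longrightarrow> t \<in> carrier G"
  unfolding conjs_def using P_carrier by auto

lemma conjs_conj:
  assumes "t \<in> conjs" "g \<in> carrier G"
  shows "inv g \<otimes> t \<otimes> g \<in> conjs" "g \<otimes> t \<otimes> inv g \<in> conjs"
proof -
  obtain x s j where x: "t = inv x \<otimes> s \<otimes> x" "x \<in> carrier G" "j \<in> I" "s \<in> P j"
    using assms unfolding conjs_def by blast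
  then show "inv g \<otimes> t \<otimes> g \<in> conjs" "g \<otimes> t \<otimes> inv g \<in> conjs"
    using conjsI[of "x \<otimes> g" j s] conjsI[of "x \<otimes> inv g" j s] assms(2) P_carrier[of j s]
    by (auto simp: inv_mult_group m_assoc)
qed

text \<open>While \<open>s\<close> lies in \<open>P i\<close> for the factor \<open>i\<close> of the
  next syllable, normality absorbs that syllable into \<open>s\<close>. Otherwise, as the
  subsemigroups agree on \<open>C\<close>, \<open>s\<close> is outside \<open>C\<close> and
  \<open>i \<noteq> j\<close>, so the remaining conjugate is already reduced.\<close>

lemma conj_wprod_cases:
  assumes "red w" "j \<in> I" "s \<in> P j"
  shows "inv (wprod w) \<otimes> s \<otimes> wprod w \<in> C \<inter> (\<Inter>k\<in>I. P k) \<or>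
    (\<exists>x r k. k \<in> I \<and> r \<in> P k \<and> r \<notin> C \<and> cyclic_form (inv (wprod w) \<otimes> s \<otimes> wprod w) x r)"
  using assms
proof (induction w arbitrary: j s)
  case Nil
  show ?case
  proof (cases "s \<in> C")
    case True
    then have "s \<in> C \<inter> (\<Inter>k\<in>I. P k)" using P_C[OF Nil(2) _ Nil(3)] by blast
    then show ?thesis using P_carrier[OF Nil(2,3)] by simp
  next
    case False
    have "len s = 1" "len (inv s) = 1" "len \<one> = 0"
      using len_Gi_le_1[OF Nil(2) P_sub[OF Nil(2,3)]] P_carrier[OF Nil(2,3)] len_inv[of s]
        len_eq_0_iff[of s] len_eq_0_iff[of \<one>] False by auto
    then have "cyclic_form (inv (wprod []) \<otimes> s \<otimes> wprod []) \<one> s"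
      using P_carrier[OF Nil(2,3)] by (simp add: cyclic_form_def)
    then show ?thesis using Nil False by blast
  qed
next
  case (Cons p w)
  obtain i x where p: "p = (i, x)" by fastforce
  have i: "i \<in> I" "x \<in> Gi i" "x \<in> carrier G" "wprod w \<in> carrier G" "red w"
    using Cons.prems(1) p Gi_carrier by auto
  have s: "s \<in> carrier G" "s \<in> Gi j" using Cons.prems P_carrier P_sub by auto
  let ?W = "wprod (p # w)"
  have W: "?W \<in> carrier G" using Cons.prems wprod_closed by blast
  show ?case
  proof (cases "s \<in> P i")
    case True
    have "inv ?W \<otimes> s \<otimes> ?W = inv (wprod w) \<otimes> (inv x \<otimes> s \<otimes> x) \<otimes> wprod w"
      using p i s by (simp add: inv_mult_group m_assoc)
    then show ?thesis using Cons.IH[OF i(5,1) P_conj[OF i(1) True i(2)]] by simp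
  next
    case False
    then have sC: "s \<notin> C" and ij: "i \<noteq> j" using P_C[OF Cons.prems(2) i(1)] Cons.prems by auto
    have s1: "len s = 1"
      using len_Gi_le_1[OF Cons.prems(2) s(2)] len_eq_0_iff[OF s(1)] sC by auto
    have "inv s \<in> Gi j" "inv s \<notin> C"
      using s sC Gi_closed(1)[OF Cons.prems(2)] mult_notin_C(3)[of s \<one>] by auto
    then have r: "red ((j, s) # p # w)" "red ((j, inv s) # p # w)"
      using Cons.prems s sC p ij by auto
    have "has_len (inv ?W \<otimes> (\<one> \<otimes> wprod ((j, s) # p # w))) (length (p # w) + length ((j, s) # p # w))"
      using Cons.prems(1) r ij p by (intro has_len_no_cancel) auto
    then have "len (inv ?W \<otimes> s \<otimes> ?W) = length (p # w) + length ((j, s) # p # w)"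
      using W s len_eqI by (simp add: m_assoc del: wprod.simps(2)) (simp add: m_assoc)
    moreover have "len ?W = length (p # w)"
      using len_wprod[of \<one> "p # w"] Cons.prems(1) W by simp
    moreover have "len (s \<otimes> ?W) = Suc (length (p # w))" "len (inv s \<otimes> ?W) = Suc (length (p # w))"
      using len_wprod[OF C_closed(1) r(1)] len_wprod[OF C_closed(1) r(2)] W s by auto
    ultimately have "cyclic_form (inv ?W \<otimes> s \<otimes> ?W) ?W s"
      using W s s1 by (simp add: cyclic_form_def)
    then show ?thesis using Cons.prems sC by blast
  qed
qed

lemma conjs_cases:
  assumes "t \<in> conjs"
  obtains "t \<in> C" "\<And>k. k \<in> I \<Longrightarrow> t \<in> P k"
    | x s j where "j \<in> I" "s \<in> P j" "s \<notin> C" "t \<notin> C" "cyclic_form t x s"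
proof -
  obtain g s j where g: "t = inv g \<otimes> s \<otimes> g" "g \<in> carrier G" "j \<in> I" "s \<in> P j"
    using assms unfolding conjs_def by blast
  obtain c w where w: "c \<in> C" "red w" "g = c \<otimes> wprod w" using normal_form[OF g(2)] .
  \<comment> \<open>The coefficient \<open>c\<close> moves into \<open>s\<close>, which stays in
    \<open>P j\<close> by normality.\<close>
  have t: "t = inv (wprod w) \<otimes> (inv c \<otimes> s \<otimes> c) \<otimes> wprod w"
    using g(1) w P_carrier[OF g(3,4)] by (simp add: inv_mult_group m_assoc)
  have "inv c \<otimes> s \<otimes> c \<in> P j" using P_conj[OF g(3,4) C_sub_Gi[OF g(3) w(1)]] .
  from conj_wprod_cases[OF w(2) g(3) this, folded t] show thesis
  proof (elim disjE exE conjE)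
    assume "t \<in> C \<inter> (\<Inter>k\<in>I. P k)"
    then show thesis by (intro that(1)) auto
  next
    fix x r k
    assume *: "k \<in> I" "r \<in> P k" "r \<notin> C" "cyclic_form t x r"
    then have "t \<notin> C"
      using len_eq_0_iff[OF conjs_carrier[OF assms]] cyclic_formD(5)[OF *(4)] by simp
    then show thesis using that(2) * by blast
  qed
qed

lemma conjs_len: "t \<in> conjs \<Longrightarrow> t \<in> C \<or> odd (len t)"
  using cyclic_formD(5) by (elim conjs_cases) simp_all

text \<open>The hypotheses force both elements to fix the same vertex of the Bass--Serre tree.\<close>

lemma conjs_mult:
  assumes a: "a \<in> conjs" and b: "b \<in> conjs" and eq: "len a = len b" and le: "len (a \<otimes> b) \<le> len b"
  shows "a \<otimes> b \<in> conjs"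
  using b
proof (cases rule: conjs_cases)
  case 1
  then have "a \<in> C"
    using eq len_eq_0_iff[OF conjs_carrier[OF a]] len_eq_0_iff[OF conjs_carrier[OF b]] by simp
  with a show ?thesis
  proof (cases rule: conjs_cases)
    case (2 x s j)
    then show ?thesis using \<open>a \<in> C\<close> by simp
  next
    case a1: 1
    obtain j where "j \<in> I" using b unfolding conjs_def by blast
    then show ?thesis using P_conjs[OF _ P_mult] a1 1 by blast
  qed
next
  case (2 y r k)
  note b2 = 2
  from a show ?thesis
  proof (cases rule: conjs_cases)
    case 1
    then show ?thesis
      using b2(4) eq len_eq_0_iff[OF conjs_carrier[OF a]] len_eq_0_iff[OF conjs_carrier[OF b]] by simp
  next
    case (2 x s j)
    \<comment> \<open>Once \<open>c\<close> is known to lie in \<open>C\<close>, both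
      \<open>a\<close> and \<open>b\<close> can be written with the same conjugator
      \<open>y\<close>.\<close>
    define c where "c = x \<otimes> inv y"
    note fa = cyclic_formD[OF 2(5)] and fb = cyclic_formD[OF b2(5)]
    have cl: "x \<in> carrier G" "y \<in> carrier G" "s \<in> carrier G" "r \<in> carrier G"
        "a \<in> carrier G" "b \<in> carrier G"
      using fa(1,2) fb(1,2) conjs_carrier[OF a] conjs_carrier[OF b] by auto
    have l: "len x = len y" "len (inv s \<otimes> x) = len y + 1"
      using fa(5,7) fb(5) eq by auto
    have "gp (inv a) (inv x) = 2 * int (len y)"
      using gp_cyclic_form[OF cyclic_form_inv[OF 2(5)]] l by simp
    moreover have "gp b (inv y) = 2 * int (len y)" using gp_cyclic_form[OF b2(5)] .
    moreover have "gp (inv a) b \<ge> 2 * int (len y)" using le eq fb(5) cl by (simp add: gp_def len_inv)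
    moreover have "min (gp (inv a) b) (gp b (inv y)) \<le> gp (inv a) (inv y)"
      using cl by (intro gp_hyperbolic) auto
    moreover have "min (gp (inv x) (inv a)) (gp (inv a) (inv y)) \<le> gp (inv x) (inv y)"
      using cl by (intro gp_hyperbolic) auto
    \<comment> \<open>Hyperbolicity along the chain \<open>inv x\<close>, \<open>inv a\<close>,
      \<open>b\<close>, \<open>inv y\<close>. The bound equals \<open>len x + len y\<close>, so no
      length is left for \<open>c\<close>.\<close>
    ultimately have "gp (inv x) (inv y) \<ge> 2 * int (len y)"
      using gp_commute[of "inv x" "inv a"] cl by simp
    then have "len c = 0" using cl l by (simp add: gp_def len_inv c_def)
    then have c: "c \<in> C" using cl len_eq_0_iff by (simp add: c_def)
    have x: "x = c \<otimes> y" using cl by (simp add: c_def m_assoc)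
    define q where "q = inv c \<otimes> s \<otimes> c"
    have q: "q \<in> P j" "q \<in> carrier G" "q \<in> Gi j"
      using P_conj[OF 2(1,2)] C_sub_Gi[OF 2(1) c] P_carrier[OF 2(1)] P_sub[OF 2(1)] by (auto simp: q_def)
    have qC: "q \<notin> C"
      using mult_notin_C[OF _ _ c] mult_notin_C(1)[of s "inv c"] 2(3) c cl by (simp add: q_def)
    have aq: "a = inv y \<otimes> q \<otimes> y"
      using fa(4) x c cl by (simp add: q_def inv_mult_group m_assoc)
    have prod: "a \<otimes> b = inv y \<otimes> (q \<otimes> r) \<otimes> y" using aq fb(4) cl q by (simp add: m_assoc)
    show ?thesis
    proof (cases "j = k")
      case True
      then show ?thesis unfolding prod using conjsI cl q b2 P_mult by blast
    next
      \<comment> \<open>Different factors are impossible: \<open>q\<close> and \<open>r\<close> do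
        not merge, and the chain \<open>inv q\<close>, \<open>inv q \<otimes> y\<close>,
        \<open>r \<otimes> y\<close>, \<open>r\<close> leaves no overlap in the middle, so
        \<open>len (a \<otimes> b) \<ge> 2 * len y + 2 > len b\<close>.\<close>
      case False
      have iq: "inv q \<in> carrier G" "len (inv q) = 1" "len q = 1"
        using q qC len_Gi_le_1[OF 2(1) q(3)] len_eq_0_iff[of q] len_inv[of q] by auto
      have "inv q \<otimes> y = inv c \<otimes> (inv s \<otimes> x)"
        using x c cl by (simp add: q_def inv_mult_group m_assoc)
      then have lq: "len (inv q \<otimes> y) = len y + 1" using len_C_mult c cl l by simp
      have "gp (inv q) r = 0"
        using len_Gi_mult_2[OF 2(1) b2(1) False q(3) qC P_sub[OF b2(1,2)] b2(3)] iq fb(3) q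
        by (simp add: gp_def)
      moreover have "gp (inv q) (inv q \<otimes> y) = 2"
        using iq lq q cl by (simp add: gp_def)
      moreover have "gp (r \<otimes> y) r = 2"
        using fb(3,6) cl by (subst gp_commute) (auto simp: gp_def)
      moreover have "min (gp (inv q) (inv q \<otimes> y)) (gp (inv q \<otimes> y) r) \<le> gp (inv q) r"
        using q cl by (intro gp_hyperbolic) auto
      moreover have "min (gp (inv q \<otimes> y) (r \<otimes> y)) (gp (r \<otimes> y) r) \<le> gp (inv q \<otimes> y) r"
        using q cl by (intro gp_hyperbolic) auto
      ultimately have "gp (inv q \<otimes> y) (r \<otimes> y) \<le> 0" by linarith
      moreover have "inv (inv q \<otimes> y) \<otimes> (r \<otimes> y) = a \<otimes> b"
        unfolding prod using q cl by (simp add: inv_mult_group m_assoc)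
      ultimately show ?thesis using lq fb(5,6) le by (simp add: gp_def)
    qed
  qed
qed

section \<open>Hurwitz moves and the descent\<close>

text \<open>Equal lengths allow merging by \<open>conjs_mult\<close>. If \<open>a\<close> is
  shorter, conjugating \<open>b\<close> past it does not raise the total and leaves the shorter
  \<open>a\<close> on the right; if \<open>b\<close> is shorter, conjugating \<open>a\<close> past
  it lowers the total.\<close>

lemma hurwitz_move:
  assumes a: "a \<in> conjs" and b: "b \<in> conjs"
    and le: "\<not> (len b < len (a \<otimes> b) \<and> len a \<le> len (a \<otimes> b))"
  shows "a \<otimes> b \<in> conjs \<or> (\<exists>a'\<in>conjs. \<exists>b'\<in>conjs. a' \<otimes> b' = a \<otimes> b \<and>
    (len a' + len b' < len a + len b \<or> len a' + len b' = len a + len b \<and> len b' < len b))"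
proof -
  have c: "a \<in> carrier G" "b \<in> carrier G" using a b conjs_carrier by auto
  consider "len a = len b" | "len a < len b" | "len b < len a" by linarith
  then show ?thesis
  proof cases
    case 1
    then show ?thesis using conjs_mult[OF a b] le by auto
  next
    case 2
    then have "b \<notin> C" using len_eq_0_iff[OF c(2)] by auto
    with b obtain x s where "cyclic_form b x s" by (metis conjs_cases)
    then have "len (a \<otimes> b \<otimes> inv a) \<le> len b" using len_conj_le(1) 2 le c by auto
    moreover have "(a \<otimes> b \<otimes> inv a) \<otimes> a = a \<otimes> b" using c by (simp add: m_assoc)
    ultimately show ?thesis
      using conjs_conj(2)[OF b c(1)] a 2
      by (intro disjI2 bexI[of _ "a \<otimes> b \<otimes> inv a"] bexI[of _ a]) auto
  next
    case 3
    then have lt: "len (a \<otimes> b) < len a" using le by auto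
    have "a \<notin> C" using 3 len_eq_0_iff[OF c(1)] by auto
    with a obtain x s where f: "cyclic_form a x s" by (metis conjs_cases)
    \<comment> \<open>An element of \<open>C\<close> on the right would preserve
      \<open>len a\<close>, contrary to \<open>lt\<close>. Outside \<open>C\<close>, the length of
      \<open>b\<close> is odd.\<close>
    have "b \<notin> C"
    proof
      assume "b \<in> C"
      then have "len (inv b \<otimes> inv a) = len (inv a)" using c len_C_mult by simp
      then show False using lt len_inv[of "a \<otimes> b"] c by (simp add: inv_mult_group len_inv)
    qed
    then have "odd (len (inv b))" using conjs_len[OF b] len_inv c by simp
    moreover have "len (inv b \<otimes> inv a) < len (inv a)"
      using lt len_inv[of "a \<otimes> b"] c by (simp add: inv_mult_group len_inv)
    \<comment> \<open>Inverting makes \<open>b\<close> a left factor, so \<open>len_conj_le\<close>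
      applies. The strict bound matters: in a tie the longer entry would move to the right.\<close>
    ultimately have "len (inv b \<otimes> inv a \<otimes> inv (inv b)) < len (inv a)"
      using len_conj_le(2)[OF cyclic_form_inv[OF f], of "inv b"] 3 c by (simp add: len_inv)
    moreover have "inv (inv b \<otimes> a \<otimes> b) = inv b \<otimes> inv a \<otimes> inv (inv b)"
      using c by (simp add: inv_mult_group m_assoc)
    ultimately have "len (inv b \<otimes> a \<otimes> b) < len a"
      using len_inv[of "inv b \<otimes> a \<otimes> b"] c by (simp add: len_inv)
    moreover have "b \<otimes> (inv b \<otimes> a \<otimes> b) = a \<otimes> b" using c by (simp add: m_assoc)
    ultimately show ?thesis
      using conjs_conj(1)[OF a c(2)] b
      by (intro disjI2 bexI[of _ b] bexI[of _ "inv b \<otimes> a \<otimes> b"]) auto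
  qed
qed

text \<open>This is the sum of k times the length of the k-th factor; it breaks ties in the total length
  by preferring the longer of two adjacent factors on the left.\<close>

primrec weight :: "'a list \<Rightarrow> nat" where
  "weight [] = 0"
| "weight (t # ts) = sum_list (map len (t # ts)) + weight ts"

lemma weight_append:
  "weight (ts @ us) = weight ts + length ts * sum_list (map len us) + weight us"
  by (induction ts) auto

lemma not_successively_split:
  "\<not> successively R ts \<Longrightarrow> \<exists>as a b bs. ts = as @ a # b # bs \<and> \<not> R a b"
proof (induction ts rule: induct_list012)
  case (3 x y zs)
  show ?case
  proof (cases "R x y")
    case True
    with 3 obtain as a b bs where "y # zs = as @ a # b # bs" "\<not> R a b" by auto
    then show ?thesis by (metis append_Cons)
  next
    case False
    then show ?thesis by (intro exI[of _ "[]"]) simp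
  qed
qed auto

lemma lprod_conjs_in_P:
  assumes "i \<in> I" "ts \<noteq> []" "set ts \<subseteq> conjs" "lprod ts \<in> Gi i"
  shows "lprod ts \<in> P i"
  using assms(2-)
\<comment> \<open>The measure is lexicographic; the three outcomes of \<open>hurwitz_move\<close>
  lower its first, second and third component respectively.\<close>
proof (induction ts rule: wf_induct_rule[OF wf_measures[of
    "[length, \<lambda>ts. sum_list (map len ts), weight]"]])
  case (1 ts)
  have ts: "set ts \<subseteq> carrier G" using 1(3) conjs_carrier by auto
  let ?R = "\<lambda>a b. len b < len (a \<otimes> b) \<and> len a \<le> len (a \<otimes> b)"
  consider "last ts \<in> C" | "\<not> successively ?R ts" | "last ts \<notin> C" "successively ?R ts" by blast
  then show ?case
  proof cases
    \<comment> \<open>A factor in \<open>C\<close> at any other position leaves the length of its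
      right neighbour unchanged, so it violates \<open>?R\<close> and falls under the second
      case.\<close>
    case C: 1
    obtain us t where us: "ts = us @ [t]" using 1(2) by (metis rev_exhaust)
    have t: "t \<in> P i" "t \<in> C" "t \<in> carrier G" "set us \<subseteq> carrier G"
      using conjs_cases[of t] assms(1) C us 1(3) ts by auto
    have l: "lprod ts = lprod us \<otimes> t" using us t by (simp add: lprod_append)
    show ?thesis
    proof (cases "us = []")
      case True
      then show ?thesis using l t by simp
    next
      case False
      have "lprod ts \<otimes> inv t \<in> Gi i"
        using 1(4) t(2) assms(1) Gi_closed C_sub_Gi by simp
      moreover have "lprod us = lprod ts \<otimes> inv t" using l t by (simp add: m_assoc)
      ultimately have "lprod us \<in> P i" using 1(1)[of us] 1(3) us False by simp
      then show ?thesis using l t P_mult assms(1) by simp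
    qed
  next
    case 2
    then obtain as a b bs where s: "ts = as @ a # b # bs" "\<not> ?R a b"
      using not_successively_split[of ?R ts] by blast
    have ab: "a \<in> conjs" "b \<in> conjs" "set as \<subseteq> conjs" "set bs \<subseteq> conjs" using 1(3) s by auto
    then have c: "a \<in> carrier G" "b \<in> carrier G" "set as \<subseteq> carrier G" "set bs \<subseteq> carrier G"
      using conjs_carrier by auto
    from hurwitz_move[OF ab(1,2) s(2)] show ?thesis
    proof (elim disjE bexE conjE)
      assume m: "a \<otimes> b \<in> conjs"
      have "lprod (as @ (a \<otimes> b) # bs) = lprod ts"
        using s c by (simp add: lprod_append m_assoc)
      then show ?thesis using 1(1)[of "as @ (a \<otimes> b) # bs"] 1(4) m ab s by simp
    next
      fix a' b'
      assume n: "a' \<in> conjs" "b' \<in> conjs" "a' \<otimes> b' = a \<otimes> b"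
        and lt: "len a' + len b' < len a + len b"
      have "lprod (as @ a' # b' # bs) = lprod ts"
        using s c n conjs_carrier by (simp add: lprod_append m_assoc[symmetric])
      then show ?thesis using 1(1)[of "as @ a' # b' # bs"] 1(4) n lt ab s by simp
    next
      fix a' b'
      assume n: "a' \<in> conjs" "b' \<in> conjs" "a' \<otimes> b' = a \<otimes> b"
        and lt: "len a' + len b' = len a + len b" "len b' < len b"
      have "lprod (as @ a' # b' # bs) = lprod ts"
        using s c n conjs_carrier by (simp add: lprod_append m_assoc[symmetric])
      moreover have S: "sum_list (map len (a' # b' # bs)) = sum_list (map len (a # b # bs))"
        using lt by simp
      \<comment> \<open>With equal sums \<open>S\<close>, only the suffix starting at the second
        entry changes its contribution, by \<open>len b - len b'\<close>.\<close>
      moreover have "weight (as @ a' # b' # bs) < weight ts"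
        unfolding s weight_append S using lt by simp
      ultimately show ?thesis
        using 1(1)[of "as @ a' # b' # bs"] 1(4) n ab s by (simp del: weight.simps)
    qed
  next
    case 3
    have "length ts \<le> len (lprod ts)"
      using length_le_len_lprod[OF 1(2) ts 3(1)] 3(2) by blast
    also have "\<dots> \<le> 1" using len_Gi_le_1[OF assms(1) 1(4)] .
    finally obtain t where t: "ts = [t]" using 1(2) by (cases ts) auto
    then have "t \<in> conjs" "t \<notin> C" "t \<in> carrier G" "t \<in> Gi i" using 1 3 ts by auto
    from this(1) show ?thesis
    proof (cases rule: conjs_cases)
      case 1
      then show ?thesis using \<open>t \<notin> C\<close> by simp
    next
      case (2 x s j)
      \<comment> \<open>\<open>len t = 2 * len x + 1\<close> is at most 1. Conjugating by
        \<open>x\<close> in \<open>C\<close> stays in \<open>P j\<close>, and \<open>t\<close>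
        outside \<open>C\<close> lies in both \<open>Gi i\<close> and \<open>Gi j\<close>, so
        \<open>i = j\<close>.\<close>
      then have "len x = 0" "x \<in> carrier G"
        using len_Gi_le_1[OF assms(1) \<open>t \<in> Gi i\<close>] by (auto simp: cyclic_form_def)
      then have "x \<in> C" using len_eq_0_iff by simp
      then have "t \<in> P j" using 2 P_conj C_sub_Gi by (auto simp: cyclic_form_def)
      then show ?thesis
        using Gi_Int[OF assms(1) 2(1) \<open>t \<in> Gi i\<close> P_sub[OF 2(1)]] \<open>t \<notin> C\<close> \<open>t \<in> carrier G\<close> t by simp
    qed
  qed
qed

end

theorem mainTheorem7:
  fixes G :: "('a, 'b) monoid_scheme"
    and I :: "'i set" and Gi :: "'i \<Rightarrow> 'a set" and C :: "'a set"
    and P :: "'i \<Rightarrow> 'a set" and i :: 'i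
  assumes "amalgamated_free_product G I Gi C"
    and "\<forall>j\<in>I. normal_subsemigroup (G\<lparr>carrier := Gi j\<rparr>) (P j)"
    and "\<forall>j\<in>I. \<forall>k\<in>I. P j \<inter> C = P k \<inter> C"
    and "i \<in> I"
  shows "Gi i \<inter> NSS G (\<Union>j\<in>I. P j) = P i"
proof -
  interpret group G using assms(1) by (simp add: amalgamated_free_product_def)
  interpret amalgam_nss G I Gi C P by unfold_locales (fact assms)+
  let ?conj = "\<lambda>(s, h). inv\<^bsub>G\<^esub> h \<otimes>\<^bsub>G\<^esub> s \<otimes>\<^bsub>G\<^esub> h"
  \<comment> \<open>Elements of \<open>NSS\<close> become nonempty products of members of
    \<open>conjs\<close>, as \<open>lprod_conjs_in_P\<close> expects.\<close>
  have fold: "foldr (\<lambda>(s, h) acc. (inv\<^bsub>G\<^esub> h \<otimes>\<^bsub>G\<^esub> s \<otimes>\<^bsub>G\<^esub> h) \<otimes>\<^bsub>G\<^esub> acc) ps \<one>\<^bsub>G\<^esub> = lprod (map ?conj ps)" for ps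
    by (induction ps) auto
  show ?thesis
  proof (intro subset_antisym subsetI)
    fix g
    assume "g \<in> Gi i \<inter> NSS G (\<Union>j\<in>I. P j)"
    then obtain ps where ps: "ps \<noteq> []" "\<forall>p\<in>set ps. fst p \<in> (\<Union>j\<in>I. P j) \<and> snd p \<in> carrier G"
      "g = lprod (map ?conj ps)" "g \<in> Gi i"
      unfolding NSS_def fold by blast
    have "set (map ?conj ps) \<subseteq> conjs" using ps(2) conjsI by fastforce
    then show "g \<in> P i" using lprod_conjs_in_P[OF assms(4), of "map ?conj ps"] ps by simp
  next
    fix g
    assume g: "g \<in> P i"
    have "g = lprod (map ?conj [(g, \<one>\<^bsub>G\<^esub>)])" using P_carrier[OF assms(4) g] by simp
    then have "g \<in> NSS G (\<Union>j\<in>I. P j)"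
      unfolding NSS_def fold using g assms(4)
      by (intro CollectI exI[of _ "[(g, \<one>\<^bsub>G\<^esub>)]"]) auto
    then show "g \<in> Gi i \<inter> NSS G (\<Union>j\<in>I. P j)" using P_sub assms(4) g by blast
  qed
qed

end
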